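(* Consider a Helmholtz resource theory in which each Hamiltonian $H$ corresponds to exactly one free state $G=(g,H)$, and suppose that the theory is nontrivial in the sense that equilibrating operations alone cannot generate a state that is not free. Then the free states are canonical ensembles: there is a $\beta\in\mathbb R$ such that the free state associated with every Hamiltonian $H$ has density operator $e^{-\beta H}/Z$, with $Z=\mathrm{Tr}\,e^{-\beta H}$.
   Context: A state of a Helmholtz theory is a pair $R=(\rho,H)$, where $\rho$ is a density operator commuting with the Hamiltonian $H$ on a Hilbert space and the operators have discrete, finite spectra; equivalently $R=(r,H)$, with $r$ the vector of eigenvalues of $\rho$ in an eigenbasis of $H$. Composition: $R+S=(\rho\otimes\sigma,\,H_R\otimes\mathbb 1+\mathbb 1\otimes H_S)$. An equilibrating operation on $R=(\rho,H_R)$ consists of: drawing a free state $G=(\gamma,H_G)$; applying to $R+G$ a unitary commuting with $H_R+H_G$; tracing out any subsystem associated with its own Hamiltonian.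
   Formalization: Added hypothesis: for the two-level Hamiltonian diag(0,x), the free state's population of the first level is continuous in x at x=0; without it the claim fails, e.g. when free states are normalized ground-space projectors (zero temperature). *)

theory Defs
  imports "HOL-Analysis.Analysis" "Jordan_Normal_Form.Schur_Decomposition"
begin

text \<open>
  The operators have finite spectra and density operators have trace one, so Hilbert spaces are
  finite-dimensional. A Hilbert space of dimension \<open>n \<ge> 1\<close> is identified with the space of
  complex \<open>n\<close>-vectors, and operators with \<open>n \<times> n\<close> matrices.
\<close>

definition hermitian :: "complex mat \<Rightarrow> bool" where
  "hermitian A \<longleftrightarrow> square_mat A \<and> mat_adjoint A = A"

definition unitary_on :: "nat \<Rightarrow> complex mat \<Rightarrow> bool" where
  "unitary_on n U \<longleftrightarrow> U \<in> carrier_mat n n \<and> mat_adjoint U * U = 1\<^sub>m n \<and> U * mat_adjoint U = 1\<^sub>m n"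

definition mat_trace :: "complex mat \<Rightarrow> complex" where
  "mat_trace A = (\<Sum>i<dim_row A. A $$ (i, i))"

definition density_on :: "nat \<Rightarrow> complex mat \<Rightarrow> bool" where
  "density_on n \<rho> \<longleftrightarrow> \<rho> \<in> carrier_mat n n \<and> hermitian \<rho>
     \<and> (\<forall>v \<in> carrier_vec n. 0 \<le> Re ((\<rho> *\<^sub>v v) \<bullet>c v)) \<and> mat_trace \<rho> = 1"

definition hamiltonian_on :: "nat \<Rightarrow> complex mat \<Rightarrow> bool" where
  "hamiltonian_on n H \<longleftrightarrow> 0 < n \<and> H \<in> carrier_mat n n \<and> hermitian H"

definition hamiltonian :: "complex mat \<Rightarrow> bool" where
  "hamiltonian H \<longleftrightarrow> hamiltonian_on (dim_row H) H"

text \<open>The product basis vector \<open>(i, j)\<close> has index \<open>i * dim B + j\<close>.\<close>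

definition kron :: "complex mat \<Rightarrow> complex mat \<Rightarrow> complex mat" where
  "kron A B = mat (dim_row A * dim_row B) (dim_col A * dim_col B)
     (\<lambda>(i, j). A $$ (i div dim_row B, j div dim_col B) * B $$ (i mod dim_row B, j mod dim_col B))"

definition kron_sum :: "complex mat \<Rightarrow> complex mat \<Rightarrow> complex mat" where
  "kron_sum A B = kron A (1\<^sub>m (dim_row B)) + kron (1\<^sub>m (dim_row A)) B"

text \<open>Partial trace over the first factor of an \<open>(a * b)\<close>-dimensional product space.\<close>

definition partial_trace_fst :: "nat \<Rightarrow> nat \<Rightarrow> complex mat \<Rightarrow> complex mat" where
  "partial_trace_fst a b \<rho> = mat b b (\<lambda>(i, j). \<Sum>k<a. \<rho> $$ (k * b + i, k * b + j))"

type_synonym state = "complex mat \<times> complex mat"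

definition is_state :: "state \<Rightarrow> bool" where
  "is_state R \<longleftrightarrow> (case R of (\<rho>, H) \<Rightarrow>
     hamiltonian H \<and> density_on (dim_row H) \<rho> \<and> \<rho> * H = H * \<rho>)"

definition compose :: "state \<Rightarrow> state \<Rightarrow> state" where
  "compose R S = (kron (fst R) (fst S), kron_sum (snd R) (snd S))"

text \<open>
  \<open>F\<close> is the set of free states of a Helmholtz theory in which every Hamiltonian has exactly one
  free state.
\<close>

definition unique_free_states :: "state set \<Rightarrow> bool" where
  "unique_free_states F \<longleftrightarrow> (\<forall>R \<in> F. is_state R) \<and> (\<forall>H. hamiltonian H \<longrightarrow> (\<exists>!g. (g, H) \<in> F))"

definition free_density :: "state set \<Rightarrow> complex mat \<Rightarrow> complex mat" where
  "free_density F H = (THE g. (g, H) \<in> F)"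

definition energy_preserving_evolution :: "state \<Rightarrow> state \<Rightarrow> bool" where
  "energy_preserving_evolution R S \<longleftrightarrow>
     (\<exists>U. unitary_on (dim_row (snd R)) U \<and> U * snd R = snd R * U
        \<and> S = (U * fst R * mat_adjoint U, snd R))"

text \<open>
  A subsystem with its own Hamiltonian is a tensor factor \<open>A\<close> of the Hilbert space, given by a
  unitary identification \<open>W\<close> with a product space \<open>A \<otimes> B\<close>, such that the total Hamiltonian becomes
  \<open>H\<^sub>A \<otimes> 1 + 1 \<otimes> H\<^sub>B\<close>. Since \<open>W\<close> may permute factors, tracing out the first factor is no
  restriction. The case of one-dimensional \<open>A\<close> discards nothing.
\<close>

definition discards_subsystem :: "state \<Rightarrow> state \<Rightarrow> bool" where
  "discards_subsystem R S \<longleftrightarrow>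
     (\<exists>a b W H\<^sub>A H\<^sub>B. dim_row (snd R) = a * b \<and> unitary_on (a * b) W
        \<and> hamiltonian_on a H\<^sub>A \<and> hamiltonian_on b H\<^sub>B
        \<and> W * snd R * mat_adjoint W = kron_sum H\<^sub>A H\<^sub>B
        \<and> S = (partial_trace_fst a b (W * fst R * mat_adjoint W), H\<^sub>B))"

definition equilibrating_operation :: "state set \<Rightarrow> state \<Rightarrow> state \<Rightarrow> bool" where
  "equilibrating_operation F R S \<longleftrightarrow>
     (\<exists>G \<in> F. \<exists>T. energy_preserving_evolution (compose R G) T \<and> discards_subsystem T S)"

definition nontrivial_theory :: "state set \<Rightarrow> bool" where
  "nontrivial_theory F \<longleftrightarrow> (\<forall>R \<in> F. \<forall>S. (equilibrating_operation F)\<^sup>*\<^sup>* R S \<longrightarrow> S \<in> F)"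

text \<open>The exponential series; matrix convergence is entrywise.\<close>

definition mat_exp :: "complex mat \<Rightarrow> complex mat" where
  "mat_exp A = mat (dim_row A) (dim_col A) (\<lambda>(i, j). \<Sum>k. (A ^\<^sub>m k) $$ (i, j) / fact k)"

definition canonical_density :: "real \<Rightarrow> complex mat \<Rightarrow> complex mat" where
  "canonical_density \<beta> H =
     (let E = mat_exp (complex_of_real (- \<beta>) \<cdot>\<^sub>m H) in (1 / mat_trace E) \<cdot>\<^sub>m E)"

definition qubit_hamiltonian :: "real \<Rightarrow> complex mat" where
  "qubit_hamiltonian x = mat 2 2 (\<lambda>(i, j). if i = 1 \<and> j = 1 then complex_of_real x else 0)"

text \<open>
  Regularity of the assignment of free states, in a weak form: for a two-level system, the
  population of the first level depends continuously on the gap at gap zero. Without regularity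
  the conclusion fails. Uniqueness and nontriviality hold for the normalised projectors onto ground
  spaces (\<open>\<beta> = \<infinity>\<close>), and for the density operators proportional to \<open>exp (f H)\<close>, applied spectrally,
  with \<open>f\<close> any (possibly discontinuous) additive function on the reals.
\<close>

definition regular_at_degeneracy :: "state set \<Rightarrow> bool" where
  "regular_at_degeneracy F \<longleftrightarrow> isCont (\<lambda>x. free_density F (qubit_hamiltonian x) $$ (0, 0)) 0"

end

(* Discarding a one-dimensional factor of energy 0 along an arbitrary unitary identification shows
   that H |-> g(H) is unitarily covariant and turns sums of Hamiltonians into Kronecker products.
   Covariance makes g(H) diagonal in an eigenbasis of H, with equal populations on degenerate levels.
   Let p(x) be the ground population of a qubit with gap x. Three qubits with gaps x, y, x + y have
   the degenerate levels (0,0,1) and (1,1,0), so (1 - p)/p is multiplicative, hence exp(-beta x) by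
   continuity at 0. Adding to any system a qubit with gap E_i - E_j makes (i, 0) and (j, 1)
   degenerate, so the ratio of its i-th and j-th populations is the Boltzmann factor. *)

theory Submission
  imports Defs
begin

section \<open>Adjoints and unitaries\<close>

lemma dim_mat_adjoint [simp]:
  "dim_row (mat_adjoint A) = dim_col A" "dim_col (mat_adjoint A) = dim_row A"
  unfolding mat_adjoint_def by auto

lemma mat_adjoint_carrier [simp]: "A \<in> carrier_mat n m \<Longrightarrow> mat_adjoint A \<in> carrier_mat m n"
  by (intro carrier_matI) auto

lemma index_mat_adjoint [simp]:
  fixes A :: "complex mat"
  assumes "i < dim_col A" "j < dim_row A"
  shows "mat_adjoint A $$ (i, j) = cnj (A $$ (j, i))"
  using assms unfolding mat_adjoint_def by (simp add: mat_of_rows_index)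

lemma mat_adjoint_adjoint [simp]: "mat_adjoint (mat_adjoint A) = A" for A :: "complex mat"
  by (intro eq_matI) auto

lemma mat_adjoint_one [simp]: "mat_adjoint (1\<^sub>m n :: complex mat) = 1\<^sub>m n"
  by (intro eq_matI) auto

lemma mat_adjoint_mult:
  fixes A B :: "complex mat"
  assumes "A \<in> carrier_mat n k" "B \<in> carrier_mat k m"
  shows "mat_adjoint (A * B) = mat_adjoint B * mat_adjoint A"
  using assms by (intro eq_matI) (auto simp: scalar_prod_def mult.commute)

lemma mat_adjoint_conj:
  fixes A B :: "complex mat"
  assumes "A \<in> carrier_mat n n" "B \<in> carrier_mat n n"
  shows "mat_adjoint (A * B * mat_adjoint A) = A * mat_adjoint B * mat_adjoint A"
  using assms
  by (simp add: mat_adjoint_mult[of _ n n _ n] assoc_mult_mat[of _ n n _ n _ n])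

lemma conj_conj_mat:
  fixes A B X :: "complex mat"
  assumes "A \<in> carrier_mat n n" "B \<in> carrier_mat n n" "X \<in> carrier_mat n n"
  shows "A * (B * X * mat_adjoint B) * mat_adjoint A = (A * B) * X * mat_adjoint (A * B)"
proof -
  have c: "mat_adjoint A \<in> carrier_mat n n" "mat_adjoint B \<in> carrier_mat n n" using assms by auto
  have "A * B * X \<in> carrier_mat n n" using assms by (metis mult_carrier_mat)
  then have "(A * B) * X * (mat_adjoint B * mat_adjoint A) = (A * B) * X * mat_adjoint B * mat_adjoint A"
    using c by (intro assoc_mult_mat[symmetric, of _ n n _ n _ n])
  also have "(A * B) * X * mat_adjoint B = A * (B * X * mat_adjoint B)"
    using assms c by (simp add: assoc_mult_mat[of _ n n _ n _ n])
  finally show ?thesis using assms by (simp add: mat_adjoint_mult[of _ n n _ n])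
qed

lemma unitary_onD:
  assumes "unitary_on n U"
  shows "U \<in> carrier_mat n n" "mat_adjoint U * U = 1\<^sub>m n" "U * mat_adjoint U = 1\<^sub>m n"
  using assms unfolding unitary_on_def by auto

text \<open>A left inverse of a square matrix is also a right inverse, so one of the two unitarity
  equations suffices.\<close>

lemma unitary_onI:
  assumes "U \<in> carrier_mat n n" "mat_adjoint U * U = 1\<^sub>m n"
  shows "unitary_on n U"
  using assms mat_mult_left_right_inverse[of "mat_adjoint U" n U] unfolding unitary_on_def by auto

lemma unitary_on_one [simp]: "unitary_on n (1\<^sub>m n)"
  by (intro unitary_onI) auto

lemma unitary_on_mult:
  assumes "unitary_on n U" "unitary_on n V"
  shows "unitary_on n (U * V)"
proof (intro unitary_onI)
  note U = unitary_onD[OF assms(1)] and V = unitary_onD[OF assms(2)]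
  show "U * V \<in> carrier_mat n n" using U V by simp
  have "mat_adjoint (U * V) * (U * V) = mat_adjoint V * (mat_adjoint U * U * V)"
    using U(1) V(1) by (simp add: mat_adjoint_mult[of _ n n _ n] assoc_mult_mat[of _ n n _ n _ n])
  also have "\<dots> = 1\<^sub>m n" using U V by simp
  finally show "mat_adjoint (U * V) * (U * V) = 1\<^sub>m n" .
qed

lemma unitary_conj_cancel:
  assumes "unitary_on n U" "X \<in> carrier_mat n n"
  shows "U * (mat_adjoint U * X * U) * mat_adjoint U = X"
  using conj_conj_mat[of U n "mat_adjoint U" X] unitary_onD[OF assms(1)] assms(2) by simp

text \<open>The entries of a spectral decomposition are linear in the eigenvalues \<open>f\<close>.
  Scaling, exponential and trace are all computed through this formula.\<close>

lemma index_conj_mat_diag: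
  fixes V :: "complex mat"
  assumes "V \<in> carrier_mat n n" "i < n" "j < n"
  shows "(V * mat_diag n f * mat_adjoint V) $$ (i, j) = (\<Sum>l<n. V $$ (i, l) * f l * cnj (V $$ (j, l)))"
  using assms
  by (simp add: mat_diag_mult_right[of V n n] scalar_prod_def atLeast0LessThan)

section \<open>The spectral theorem\<close>

text \<open>Complete \<open>v\<close> to a basis, orthogonalise with \<open>v\<close> in front so
  that it stays unchanged, and normalise the resulting columns.\<close>

lemma unitary_with_first_column:
  fixes v :: "complex vec"
  assumes v: "v \<in> carrier_vec n" "v \<noteq> 0\<^sub>v n"
  shows "\<exists>W c. unitary_on n W \<and> col W 0 = c \<cdot>\<^sub>v v"
proof -
  interpret cof_vec_space n "TYPE(complex)" .
  define b where "b = basis_completion v"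
  define ws where "ws = gram_schmidt n b"
  from basis_completion[OF v, folded b_def]
  have dist: "distinct b" and indep: "\<not> lin_dep (set b)" and b: "set b \<subseteq> carrier_vec n"
    and hdb: "hd b = v" and len: "length b = n" by auto
  have n: "0 < n" using v by (cases n) auto
  with hdb len obtain vs where bv: "b = v # vs" by (cases b) auto
  from gram_schmidt_result[OF b dist indep refl, folded ws_def]
  have ws: "set ws \<subseteq> carrier_vec n" "corthogonal ws" "length ws = n" by (auto simp: len)
  from gram_schmidt_hd[OF v(1), of vs, folded bv] have hdws: "hd ws = v" unfolding ws_def .
  have wsc: "ws ! i \<in> carrier_vec n" if "i < n" for i using ws that by auto
  \<comment> \<open>Gram-Schmidt yields orthogonal vectors of arbitrary length; \<open>c w\<close>
    is the reciprocal of the norm of \<open>w\<close>.\<close>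
  define c where "c w = 1 / complex_of_real (sqrt (Re (w \<bullet>c w)))" for w :: "complex vec"
  define W where "W = mat n n (\<lambda>(i, j). c (ws ! j) * vec_index (ws ! j) i)"
  have W: "W \<in> carrier_mat n n" unfolding W_def by simp
  have "mat_adjoint W * W = 1\<^sub>m n"
  proof (intro eq_matI)
    fix i j assume "i < dim_row (1\<^sub>m n :: complex mat)" "j < dim_col (1\<^sub>m n :: complex mat)"
    then have ij: "i < n" "j < n" by auto
    have dims: "dim_vec (ws ! i) = n" "dim_vec (ws ! j) = n" using wsc ij by auto
    have "(mat_adjoint W * W) $$ (i, j) = cnj (c (ws ! i)) * c (ws ! j) * (ws ! j \<bullet>c ws ! i)"
      using ij dims unfolding W_def
      by (simp add: scalar_prod_def sum_distrib_left algebra_simps)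
    also have "\<dots> = 1\<^sub>m n $$ (i, j)"
    proof (cases "i = j")
      case True
      define s where "s = ws ! i \<bullet>c ws ! i"
      have "s \<noteq> 0" using corthogonalD[OF ws(2), of i i] ij ws unfolding s_def by auto
      moreover have "0 \<le> s" unfolding s_def by (rule conjugate_square_ge_0_vec)
      \<comment> \<open>The squared norm \<open>s\<close> is a positive real, so the two square
        roots coming from \<open>c\<close> multiply to \<open>s\<close> and cancel it.\<close>
      ultimately have s: "s = complex_of_real (Re s)" "0 < Re s"
        by (auto simp: less_eq_complex_def complex_eq_iff)
      have "cnj (c (ws ! i)) * c (ws ! i) * s
          = s / (complex_of_real (sqrt (Re s)) * complex_of_real (sqrt (Re s)))"
        unfolding c_def s_def[symmetric] by simp
      also have "complex_of_real (sqrt (Re s)) * complex_of_real (sqrt (Re s)) = s"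
        using s by (metis of_real_mult real_sqrt_mult_self abs_of_pos)
      also have "s / s = 1" using \<open>s \<noteq> 0\<close> by simp
      finally show ?thesis using True ij unfolding s_def by simp
    next
      case False
      then have "ws ! j \<bullet>c ws ! i = 0" using corthogonalD[OF ws(2), of j i] ij ws by auto
      then show ?thesis using False ij by simp
    qed
    finally show "(mat_adjoint W * W) $$ (i, j) = 1\<^sub>m n $$ (i, j)" .
  qed (use W in auto)
  moreover have "col W 0 = c v \<cdot>\<^sub>v v"
  proof -
    have "ws ! 0 = v" using hdws ws(3) n by (cases ws) auto
    then show ?thesis using n v(1) unfolding W_def by (intro eq_vecI) auto
  qed
  ultimately show ?thesis using unitary_onI[OF W] by blast
qed

lemma mult_block_diag:
  fixes A1 A2 D1 D2 :: "complex mat"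
  assumes "A1 \<in> carrier_mat n n" "A2 \<in> carrier_mat n n" "D1 \<in> carrier_mat m m" "D2 \<in> carrier_mat m m"
  shows "four_block_mat A1 (0\<^sub>m n m) (0\<^sub>m m n) D1 * four_block_mat A2 (0\<^sub>m n m) (0\<^sub>m m n) D2
    = four_block_mat (A1 * A2) (0\<^sub>m n m) (0\<^sub>m m n) (D1 * D2)"
proof -
  have z: "0\<^sub>m n m \<in> carrier_mat n m" "0\<^sub>m m n \<in> carrier_mat m n" by auto
  have p: "A1 * A2 \<in> carrier_mat n n" "D1 * D2 \<in> carrier_mat m m" using assms by auto
  show ?thesis
    unfolding mult_four_block_mat[OF assms(1) z assms(3) assms(2) z assms(4)]
    using assms p by (simp add: left_mult_zero_mat[of _ _ _ n] left_mult_zero_mat[of _ _ _ m]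
        right_mult_zero_mat[of _ n] right_mult_zero_mat[of _ m])
qed

lemma exists_eigenvector:
  fixes A :: "complex mat"
  assumes "A \<in> carrier_mat n n" "0 < n"
  obtains v e where "v \<in> carrier_vec n" "v \<noteq> 0\<^sub>v n" "A *\<^sub>v v = e \<cdot>\<^sub>v v"
proof -
  have "\<not> constant (poly (char_poly A))"
    using degree_monic_char_poly[OF assms(1)] assms(2) by (simp add: constant_degree)
  then obtain e where "poly (char_poly A) e = 0" using fundamental_theorem_of_algebra by blast
  then have "eigenvalue A e" using eigenvalue_root_char_poly[OF assms(1)] by simp
  then show ?thesis using that assms unfolding eigenvalue_def eigenvector_def by auto
qed

text \<open>Deflation by induction on the dimension: a unitary whose first column is an eigenvector
  turns \<open>H\<close> into a block sum of the eigenvalue and a smaller Hermitian matrix, to which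
  the induction hypothesis applies.\<close>

theorem hermitian_unitarily_diagonalizable:
  fixes H :: "complex mat"
  assumes "H \<in> carrier_mat n n" "hermitian H"
  shows "\<exists>V d. unitary_on n V \<and> H = V * mat_diag n (\<lambda>i. complex_of_real (d i)) * mat_adjoint V"
  using assms
proof (induction n arbitrary: H)
  case 0
  then show ?case by (intro exI[of _ "1\<^sub>m 0"] exI[of _ "\<lambda>_. 0"]) (auto intro!: eq_matI)
next
  case (Suc m)
  let ?n = "Suc m"
  note H = Suc.prems(1)
  obtain v e where v: "v \<in> carrier_vec ?n" "v \<noteq> 0\<^sub>v ?n" "H *\<^sub>v v = e \<cdot>\<^sub>v v"
    using exists_eigenvector[OF H] by auto
  obtain W c where W: "unitary_on ?n W" and col: "col W 0 = c \<cdot>\<^sub>v v"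
    using unitary_with_first_column[OF v(1,2)] by blast
  note Wd = unitary_onD[OF W]
  define M where "M = mat_adjoint W * H * W"
  have M: "M \<in> carrier_mat ?n ?n" unfolding M_def using Wd H by (intro mult_carrier_mat[of _ ?n ?n _ ?n]) auto
  have Hadj: "mat_adjoint H = H" using Suc.prems(2) unfolding hermitian_def by simp
  have Madj: "mat_adjoint M = M"
    using mat_adjoint_conj[of "mat_adjoint W" ?n H] Wd H Hadj unfolding M_def by simp
  have Mcnj: "cnj (M $$ (i, j)) = M $$ (j, i)" if "i < ?n" "j < ?n" for i j
    using index_mat_adjoint[of j M i] that M Madj by simp
  \<comment> \<open>The first column of \<open>W\<close> is an eigenvector of \<open>H\<close> and
    the columns of \<open>W\<close> are orthonormal, so the first column of \<open>M\<close> is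
    \<open>e\<close> times the first unit vector.\<close>
  have M0: "M $$ (i, 0) = (if i = 0 then e else 0)" if i: "i < ?n" for i
  proof -
    have "col (H * W) 0 = H *\<^sub>v col W 0" using H Wd(1) by (intro col_mult2[of _ ?n ?n _ ?n]) auto
    also have "\<dots> = e \<cdot>\<^sub>v col W 0"
      unfolding col using v H by (simp add: mult_mat_vec smult_smult_assoc mult.commute)
    finally have colHW: "col (H * W) 0 = e \<cdot>\<^sub>v col W 0" .
    have "M = mat_adjoint W * (H * W)"
      unfolding M_def using Wd H by (simp add: assoc_mult_mat[of _ ?n ?n _ ?n _ ?n])
    then have "M $$ (i, 0) = row (mat_adjoint W) i \<bullet> col (H * W) 0"
      using i Wd H by simp
    also have "\<dots> = e * (row (mat_adjoint W) i \<bullet> col W 0)"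
      unfolding colHW using Wd by simp
    also have "row (mat_adjoint W) i \<bullet> col W 0 = (mat_adjoint W * W) $$ (i, 0)"
      using Wd(1) i by simp
    finally show ?thesis using i Wd(2) by simp
  qed
  \<comment> \<open>A diagonal entry of a Hermitian matrix is real, hence so is the
    eigenvalue.\<close>
  have e: "e = complex_of_real (Re e)"
    using Mcnj[of 0 0] M0[of 0] by (simp add: complex_eq_iff)
  define H' where "H' = mat m m (\<lambda>(i, j). M $$ (Suc i, Suc j))"
  have H': "H' \<in> carrier_mat m m" unfolding H'_def by simp
  have "mat_adjoint H' = H'"
    using H' by (intro eq_matI) (auto simp: H'_def Mcnj)
  then have "hermitian H'" using H' unfolding hermitian_def by simp
  from Suc.IH[OF H' this] obtain V' d' where V': "unitary_on m V'"
    and eq': "H' = V' * mat_diag m (\<lambda>i. complex_of_real (d' i)) * mat_adjoint V'" by blast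
  note Vd = unitary_onD[OF V']
  define d where "d i = (case i of 0 \<Rightarrow> Re e | Suc k \<Rightarrow> d' k)" for i
  let ?Z = "0\<^sub>m 1 m :: complex mat" and ?Z' = "0\<^sub>m m 1 :: complex mat"
  let ?E = "mat 1 1 (\<lambda>_. e) :: complex mat"
  \<comment> \<open>\<open>V\<close> fixes the eigenvector, now the first basis vector, and
    diagonalises the remaining block.\<close>
  define V where "V = four_block_mat (1\<^sub>m 1) ?Z ?Z' V'"
  have V: "V \<in> carrier_mat ?n ?n"
    using four_block_carrier_mat[of "1\<^sub>m 1" 1 1 V' m m] Vd(1) unfolding V_def by simp
  have adjV: "mat_adjoint V = four_block_mat (1\<^sub>m 1) ?Z ?Z' (mat_adjoint V')"
    using Vd(1) unfolding V_def by (intro eq_matI) auto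
  have D: "mat_diag ?n (\<lambda>i. complex_of_real (d i))
      = four_block_mat ?E ?Z ?Z' (mat_diag m (\<lambda>i. complex_of_real (d' i)))"
    using e by (intro eq_matI) (auto simp: mat_diag_def d_def split: nat.split)
  have "mat_adjoint V * V = four_block_mat (1\<^sub>m 1) ?Z ?Z' (1\<^sub>m m)"
    unfolding adjV unfolding V_def using Vd by (subst mult_block_diag) auto
  also have "\<dots> = 1\<^sub>m ?n" by (intro eq_matI) auto
  finally have uV: "unitary_on ?n V" using unitary_onI[OF V] by blast
  have "V * mat_diag ?n (\<lambda>i. complex_of_real (d i)) * mat_adjoint V = four_block_mat ?E ?Z ?Z' H'"
    unfolding adjV D eq' unfolding V_def
    using Vd(1) by (simp add: mult_block_diag mult_carrier_mat[of _ m m] del: One_nat_def)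
  also have "\<dots> = M"
  \<comment> \<open>The first row of \<open>M\<close> vanishes off the diagonal because its first
    column does and \<open>M\<close> is Hermitian (\<open>Mcnj\<close>).\<close>
  proof (intro eq_matI)
    fix i j assume "i < dim_row M" "j < dim_col M"
    then show "four_block_mat ?E ?Z ?Z' H' $$ (i, j) = M $$ (i, j)"
      using M M0[of i] M0[of j] Mcnj[of j 0] unfolding H'_def by (cases i; cases j) auto
  qed (use M H' in auto)
  finally have "M = V * mat_diag ?n (\<lambda>i. complex_of_real (d i)) * mat_adjoint V" by simp
  moreover have "W * M * mat_adjoint W = H"
    unfolding M_def using unitary_conj_cancel[OF W H] .
  ultimately have "H = (W * V) * mat_diag ?n (\<lambda>i. complex_of_real (d i)) * mat_adjoint (W * V)"
    using conj_conj_mat[OF Wd(1) V] by simp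
  then show ?case using unitary_on_mult[OF W uV] by blast
qed

section \<open>Canonical densities\<close>

lemma mat_diag_pow: "mat_diag n f ^\<^sub>m k = mat_diag n (\<lambda>i. f i ^ k)" for f :: "nat \<Rightarrow> complex"
proof (induction k)
  case 0
  show ?case by (intro eq_matI) (auto simp: mat_diag_def)
next
  case (Suc k)
  then show ?case by (simp add: mult.commute)
qed

text \<open>Powers pass through the conjugation by similarity, so each entry of the matrix series is
  a finite combination of scalar exponential series.\<close>

lemma mat_exp_conj_mat_diag:
  assumes V: "unitary_on n V"
  shows "mat_exp (V * mat_diag n f * mat_adjoint V) = V * mat_diag n (\<lambda>i. exp (f i)) * mat_adjoint V"
    (is "mat_exp ?A = ?R")
proof -
  note Vd = unitary_onD[OF V]
  have A: "?A \<in> carrier_mat n n" "?R \<in> carrier_mat n n" using Vd by auto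
  have pow: "?A ^\<^sub>m k = V * mat_diag n (\<lambda>i. f i ^ k) * mat_adjoint V" for k
  proof -
    have "similar_mat_wit ?A (mat_diag n f) V (mat_adjoint V)"
      using Vd by (intro similar_mat_witI[of _ _ n]) auto
    from similar_mat_wit_pow[OF this, of k] show ?thesis
      by (simp add: similar_mat_wit_def Let_def mat_diag_pow)
  qed
  show ?thesis
  proof (intro eq_matI)
    fix i j assume "i < dim_row ?R" "j < dim_col ?R"
    then have ij: "i < n" "j < n" using A by auto
    have "(\<lambda>k. \<Sum>l<n. V $$ (i, l) * (f l ^ k /\<^sub>R fact k) * cnj (V $$ (j, l)))
        sums (\<Sum>l<n. V $$ (i, l) * exp (f l) * cnj (V $$ (j, l)))"
      by (intro sums_sum sums_mult sums_mult2 exp_converges)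
    moreover have "(\<lambda>k. \<Sum>l<n. V $$ (i, l) * (f l ^ k /\<^sub>R fact k) * cnj (V $$ (j, l)))
        = (\<lambda>k. (?A ^\<^sub>m k) $$ (i, j) / fact k)"
      unfolding pow index_conj_mat_diag[OF Vd(1) ij]
      by (simp add: sum_divide_distrib scaleR_conv_of_real field_simps)
    ultimately show "mat_exp ?A $$ (i, j) = ?R $$ (i, j)"
      using ij A Vd(1) unfolding mat_exp_def index_conj_mat_diag[OF Vd(1) ij]
      by (simp add: sums_unique[symmetric])
  qed (use A in \<open>auto simp: mat_exp_def\<close>)
qed

text \<open>After exchanging the sums, each eigenvalue is weighted by the squared norm of a column
  of \<open>V\<close>, which is 1.\<close>

lemma mat_trace_conj_mat_diag:
  assumes V: "unitary_on n V"
  shows "mat_trace (V * mat_diag n f * mat_adjoint V) = (\<Sum>l<n. f l)"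
proof -
  note Vd = unitary_onD[OF V]
  have "mat_trace (V * mat_diag n f * mat_adjoint V)
      = (\<Sum>i<n. \<Sum>l<n. V $$ (i, l) * f l * cnj (V $$ (i, l)))"
    unfolding mat_trace_def using Vd(1) by (intro sum.cong) (auto simp: index_conj_mat_diag simp del: index_mult_mat(1))
  also have "\<dots> = (\<Sum>l<n. f l * (mat_adjoint V * V) $$ (l, l))"
    using Vd(1) by (subst sum.swap)
      (simp add: scalar_prod_def sum_distrib_left atLeast0LessThan mult_ac)
  finally show ?thesis using Vd(2) by simp
qed

text \<open>Exponential and trace act on the eigenvalues alone, and a scalar moves into the
  diagonal. Free states are compared with the canonical ones in this form.\<close>

lemma canonical_density_conj_mat_diag:
  assumes V: "unitary_on n V"
  shows "canonical_density \<beta> (V * mat_diag n (\<lambda>i. complex_of_real (d i)) * mat_adjoint V)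
    = V * mat_diag n (\<lambda>i. complex_of_real (exp (- \<beta> * d i) / (\<Sum>l<n. exp (- \<beta> * d l)))) * mat_adjoint V"
proof -
  note Vd = unitary_onD[OF V]
  have smult: "c \<cdot>\<^sub>m (V * mat_diag n f * mat_adjoint V) = V * mat_diag n (\<lambda>i. c * f i) * mat_adjoint V" for c f
    using Vd(1) by (intro eq_matI)
      (simp_all add: index_conj_mat_diag[of V n] sum_distrib_left mult_ac del: index_mult_mat(1))
  have e: "exp (complex_of_real (- \<beta>) * complex_of_real (d i)) = complex_of_real (exp (- \<beta> * d i))" for i
    by (simp add: exp_of_real[symmetric])
  show ?thesis
    unfolding canonical_density_def Let_def smult mat_exp_conj_mat_diag[OF V]
      mat_trace_conj_mat_diag[OF V] e
    by simp
qed

section \<open>Additive functions and the two-level functional equation\<close>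

text \<open>Subtracting the linear part leaves an additive \<open>h\<close> that vanishes on the
  integers and so has period 1. Continuity at 0 bounds \<open>h\<close> on the unit interval, hence
  everywhere, and a bounded additive function is zero.\<close>

lemma additive_isCont_imp_linear:
  fixes f :: "real \<Rightarrow> real"
  assumes add: "\<And>x y. f (x + y) = f x + f y" and cont: "isCont f 0"
  shows "f x = x * f 1"
proof -
  define h where "h x = f x - x * f 1" for x
  have hadd: "h (x + y) = h x + h y" for x y unfolding h_def add by (simp add: algebra_simps)
  have h0: "h 0 = 0" using hadd[of 0 0] by simp
  have h1: "h 1 = 0" unfolding h_def by simp
  have hnat: "h (real n * x) = real n * h x" for n x
    by (induction n) (auto simp: h0 hadd algebra_simps)
  have hneg: "h (- x) = - h x" for x using hadd[of x "- x"] h0 by simp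
  have hint: "h (of_int k) = 0" for k
    using hnat[of _ 1] hneg h1 by (cases k rule: int_cases2) auto
  have "isCont h 0" unfolding h_def by (intro continuous_intros cont)
  then obtain \<delta> where \<delta>: "0 < \<delta>" "\<And>y. \<bar>y\<bar> < \<delta> \<Longrightarrow> \<bar>h y\<bar> < 1"
    unfolding continuous_at_eps_delta using h0 by (auto simp: dist_real_def dest: spec[of _ 1])
  obtain N where N: "0 < N" "1 / real N < \<delta>"
    using real_arch_invD[OF \<delta>(1)] by (auto simp: inverse_eq_divide)
  \<comment> \<open>Dividing by \<open>N\<close> moves the unit interval into the neighbourhood
    where \<open>h\<close> stays below 1; additivity scales the bound back by
    \<open>N\<close>.\<close>
  have bound: "\<bar>h t\<bar> \<le> real N" if "0 \<le> t" "t < 1" for t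
  proof -
    have "\<bar>t / N\<bar> < \<delta>" using that N divide_right_mono[of t 1 "real N"] by auto
    then have "\<bar>h (t / N)\<bar> < 1" by (rule \<delta>(2))
    then show ?thesis using hnat[of N "t / N"] N(1) by (simp add: abs_mult)
  qed
  \<comment> \<open>All multiples of \<open>h x\<close> obey one bound, since an integer part
    contributes nothing to \<open>h\<close>.\<close>
  have "real n * \<bar>h x\<bar> \<le> real N" for n
  proof -
    have "h (real n * x) = h (frac (real n * x)) + h (of_int \<lfloor>real n * x\<rfloor>)"
      unfolding hadd[symmetric] by (simp add: frac_def)
    then have "real n * \<bar>h x\<bar> = \<bar>h (frac (real n * x))\<bar>"
      unfolding hnat hint by (metis abs_mult abs_of_nat add.right_neutral)
    then show ?thesis using bound[OF frac_ge_0 frac_lt_1] by simp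
  qed
  then have "h x = 0"
    by (metis abs_le_zero_iff linorder_not_le reals_Archimedean3)
  then show ?thesis unfolding h_def by simp
qed

text \<open>Where \<open>p\<close> avoids 0 and 1, the equation says that
  \<open>(1 - p x) / p x\<close> turns sums into products. Once this holds everywhere, the logarithm
  is additive and continuous at 0, hence linear.\<close>

lemma two_level_functional_equation:
  fixes p :: "real \<Rightarrow> real"
  assumes eq: "\<And>x y. p x * p y * (1 - p (x + y)) = (1 - p x) * (1 - p y) * p (x + y)"
    and half: "p 0 = 1 / 2" and cont: "isCont p 0"
  shows "\<exists>\<beta>. \<forall>x. p x \<noteq> 0 \<and> 1 - p x = p x * exp (- \<beta> * x)"
proof -
  have add: "p (x + y) \<noteq> 0 \<and> p (x + y) \<noteq> 1" if "p x \<noteq> 0 \<and> p x \<noteq> 1" "p y \<noteq> 0 \<and> p y \<noteq> 1" for x y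
    using eq[of x y] that by auto
  obtain \<delta> where \<delta>: "0 < \<delta>" "\<And>y. \<bar>y\<bar> < \<delta> \<Longrightarrow> \<bar>p y - 1 / 2\<bar> < 1 / 2"
    using cont unfolding continuous_at_eps_delta half
    by (auto simp: dist_real_def dest: spec[of _ "1 / 2"])
  have near: "p y \<noteq> 0 \<and> p y \<noteq> 1" if "\<bar>y\<bar> < \<delta>" for y
    using \<delta>(2)[OF that] by auto
  have nat: "p (real (Suc n) * y) \<noteq> 0 \<and> p (real (Suc n) * y) \<noteq> 1" if "\<bar>y\<bar> < \<delta>" for n y
  proof (induction n)
    case 0
    then show ?case using near[OF that] by simp
  next
    case (Suc n)
    have "real (Suc (Suc n)) * y = real (Suc n) * y + y" by (simp add: algebra_simps)
    then show ?case using add[OF Suc near[OF that]] by simp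
  qed
  \<comment> \<open>The equation forbids leaving the set where \<open>p\<close> differs from 0 and 1, which contains a
    neighbourhood of 0 and is closed under addition.\<close>
  have ne: "p x \<noteq> 0 \<and> p x \<noteq> 1" for x
  proof -
    obtain n where n: "\<bar>x\<bar> < real n * \<delta>" using reals_Archimedean3[OF \<delta>(1)] by blast
    then have "n \<noteq> 0" using \<delta> by (cases n) auto
    then obtain m where m: "n = Suc m" by (cases n) auto
    have "\<bar>x / real n\<bar> < \<delta>" using n \<open>n \<noteq> 0\<close> by (simp add: divide_less_eq mult.commute)
    from nat[OF this, of m] show ?thesis unfolding m[symmetric] using \<open>n \<noteq> 0\<close> by simp
  qed
  define r where "r x = (1 - p x) / p x" for x
  have rne: "r x \<noteq> 0" for x using ne[of x] unfolding r_def by simp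
  have radd: "r (x + y) = r x * r y" for x y
    using eq[of x y] ne[of x] ne[of y] ne[of "x + y"] unfolding r_def
    by (simp add: divide_simps algebra_simps)
  \<comment> \<open>\<open>r x\<close> is the square of the nonzero number \<open>r (x / 2)\<close>,
    so the logarithm is available.\<close>
  have rpos: "0 < r x" for x
    using radd[of "x / 2" "x / 2"] rne[of "x / 2"] by (simp add: zero_less_mult_iff) linarith
  have "isCont (\<lambda>x. ln (r x)) 0"
    unfolding r_def using cont ne[of 0] rpos[of 0] unfolding r_def
    by (intro continuous_intros) auto
  moreover have "ln (r (x + y)) = ln (r x) + ln (r y)" for x y
    unfolding radd using rpos by (intro ln_mult_pos) auto
  ultimately have "ln (r x) = x * ln (r 1)" for x
    using additive_isCont_imp_linear[of "\<lambda>x. ln (r x)"] by blast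
  \<comment> \<open>The inverse temperature is \<open>- ln (r 1)\<close>.\<close>
  then have "r x = exp (- (- ln (r 1)) * x)" for x
    using rpos[of x] by (metis exp_ln minus_minus mult.commute)
  moreover have "1 - p x = p x * r x" for x
    using ne[of x] unfolding r_def by simp
  ultimately have "1 - p x = p x * exp (- (- ln (r 1)) * x)" for x by metis
  then show ?thesis using ne by blast
qed

section \<open>Kronecker products\<close>

lemma dim_kron [simp]:
  "dim_row (kron A B) = dim_row A * dim_row B" "dim_col (kron A B) = dim_col A * dim_col B"
  unfolding kron_def by auto

lemma index_kron:
  assumes "i < dim_row A * dim_row B" "j < dim_col A * dim_col B"
  shows "kron A B $$ (i, j)
    = A $$ (i div dim_row B, j div dim_col B) * B $$ (i mod dim_row B, j mod dim_col B)"
  using assms unfolding kron_def by simp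

lemma kron_carrier:
  "A \<in> carrier_mat n n \<Longrightarrow> B \<in> carrier_mat m m \<Longrightarrow> kron A B \<in> carrier_mat (n * m) (n * m)"
  by (intro carrier_matI) auto

lemma kron_sum_carrier:
  "A \<in> carrier_mat n n \<Longrightarrow> B \<in> carrier_mat m m \<Longrightarrow> kron_sum A B \<in> carrier_mat (n * m) (n * m)"
  unfolding kron_sum_def by (intro carrier_matI) auto

lemma div_mod_bounds:
  fixes i n m :: nat
  assumes "i < n * m"
  shows "i div m < n" "i mod m < m"
  using assms by (auto simp: less_mult_imp_div_less intro!: mod_less_divisor) (cases m; simp)

lemma pair_index_less:
  fixes i k n m :: nat
  assumes "i < n" "k < m"
  shows "i * m + k < n * m"
proof -
  have "i * m + k < Suc i * m" using assms(2) by simp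
  also have "\<dots> \<le> n * m" using assms(1) by (intro mult_right_mono) auto
  finally show ?thesis .
qed

lemma kron_one_right: "A \<in> carrier_mat n n \<Longrightarrow> kron A (1\<^sub>m 1) = A"
  by (intro eq_matI) (auto simp: index_kron)

lemma kron_one_left: "A \<in> carrier_mat n n \<Longrightarrow> kron (1\<^sub>m 1) A = A"
  by (intro eq_matI) (auto simp: index_kron)

lemma kron_zero_left: "kron (0\<^sub>m 1 1) (1\<^sub>m n) = 0\<^sub>m n n"
  by (intro eq_matI) (auto simp: index_kron)

lemma kron_zero_right: "kron (1\<^sub>m n) (0\<^sub>m 1 1) = 0\<^sub>m n n"
  by (intro eq_matI) (auto simp: index_kron)

lemma kron_sum_zero_left: "A \<in> carrier_mat n n \<Longrightarrow> kron_sum (0\<^sub>m 1 1) A = A"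
  unfolding kron_sum_def by (simp add: kron_one_left kron_zero_left del: One_nat_def)

lemma kron_sum_zero_right: "A \<in> carrier_mat n n \<Longrightarrow> kron_sum A (0\<^sub>m 1 1) = A"
  unfolding kron_sum_def by (simp add: kron_one_right kron_zero_right del: One_nat_def)

lemma kron_mat_diag:
  "kron (mat_diag n f) (mat_diag m h) = mat_diag (n * m) (\<lambda>k. f (k div m) * h (k mod m))"
proof (intro eq_matI)
  fix i j assume "i < dim_row (mat_diag (n * m) (\<lambda>k. f (k div m) * h (k mod m)))"
    "j < dim_col (mat_diag (n * m) (\<lambda>k. f (k div m) * h (k mod m)))"
  then have ij: "i < n * m" "j < n * m" by (auto simp: mat_diag_def)
  \<comment> \<open>A product index is determined by its quotient and remainder, so off the diagonal
    at least one factor vanishes.\<close>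
  have "i = j \<longleftrightarrow> i div m = j div m \<and> i mod m = j mod m"
    by (metis div_mult_mod_eq)
  then show "kron (mat_diag n f) (mat_diag m h) $$ (i, j)
      = mat_diag (n * m) (\<lambda>k. f (k div m) * h (k mod m)) $$ (i, j)"
    using ij div_mod_bounds[OF ij(1)] div_mod_bounds[OF ij(2)]
    by (auto simp: mat_diag_def index_kron)
qed (auto simp: mat_diag_def)

text \<open>Both summands are Kronecker products of diagonal matrices once the identity is written
  as a constant \<open>mat_diag\<close>; the energies of a composite are thus sums of
  energies.\<close>

lemma kron_sum_mat_diag:
  "kron_sum (mat_diag n f) (mat_diag m h) = mat_diag (n * m) (\<lambda>k. f (k div m) + h (k mod m))"
proof -
  have dim: "dim_row (mat_diag k f) = k" for k and f :: "nat \<Rightarrow> complex"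
    by (simp add: mat_diag_def)
  show ?thesis
    unfolding kron_sum_def dim mat_diag_one[symmetric] kron_mat_diag
    by (intro eq_matI) (auto simp: mat_diag_def)
qed

section \<open>Hermiticity and Hamiltonians of composite and rotated systems\<close>

lemma hermitian_index:
  assumes "hermitian A" "i < dim_row A" "j < dim_row A"
  shows "cnj (A $$ (j, i)) = A $$ (i, j)"
  using assms index_mat_adjoint[of i A j] unfolding hermitian_def by simp

lemma hermitian_kron:
  assumes "hermitian A" "hermitian B"
  shows "hermitian (kron A B)"
proof -
  have sq: "dim_col A = dim_row A" "dim_col B = dim_row B" using assms by (auto simp: hermitian_def)
  have "mat_adjoint (kron A B) = kron A B"
  proof (intro eq_matI)
    fix i j assume "i < dim_row (kron A B)" "j < dim_col (kron A B)"
    then have ij: "i < dim_row A * dim_row B" "j < dim_row A * dim_row B" using sq by auto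
    then show "mat_adjoint (kron A B) $$ (i, j) = kron A B $$ (i, j)"
      using div_mod_bounds[OF ij(1)] div_mod_bounds[OF ij(2)] assms sq
      by (simp add: index_kron hermitian_index)
  qed (use sq in auto)
  then show ?thesis using sq unfolding hermitian_def by simp
qed

lemma hermitian_one: "hermitian (1\<^sub>m n)"
  unfolding hermitian_def by simp

lemma hermitian_kron_sum:
  assumes "hermitian A" "hermitian B"
  shows "hermitian (kron_sum A B)"
proof -
  have sq: "dim_col A = dim_row A" "dim_col B = dim_row B" using assms by (auto simp: hermitian_def)
  define X Y where "X = kron A (1\<^sub>m (dim_row B))" and "Y = kron (1\<^sub>m (dim_row A)) B"
  have h: "hermitian X" "hermitian Y"
    unfolding X_def Y_def using assms by (auto intro!: hermitian_kron hermitian_one)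
  have dims: "dim_row X = dim_row Y" "dim_col X = dim_row Y" "dim_col Y = dim_row Y"
    using sq unfolding X_def Y_def by auto
  have "mat_adjoint (X + Y) = X + Y"
    using dims hermitian_index[OF h(1)] hermitian_index[OF h(2)] by (intro eq_matI) auto
  then show ?thesis using dims unfolding kron_sum_def hermitian_def X_def[symmetric] Y_def[symmetric]
    by simp
qed

lemma partial_trace_fst_one: "A \<in> carrier_mat n n \<Longrightarrow> partial_trace_fst 1 n A = A"
  unfolding partial_trace_fst_def by (intro eq_matI) auto

text \<open>The one-level system of energy 0 is neutral for composition. It serves both as the
  discarded factor and as the added free system.\<close>

lemma hamiltonian_on_zero: "hamiltonian_on 1 (0\<^sub>m 1 1)"
  unfolding hamiltonian_on_def hermitian_def by (auto intro!: eq_matI)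

lemma hamiltonian_on_conj:
  assumes "hamiltonian_on n H" "unitary_on n W"
  shows "hamiltonian_on n (W * H * mat_adjoint W)"
proof -
  have H: "0 < n" "H \<in> carrier_mat n n" "mat_adjoint H = H"
    using assms(1) unfolding hamiltonian_on_def hermitian_def by auto
  note W = unitary_onD(1)[OF assms(2)]
  have c: "W * H * mat_adjoint W \<in> carrier_mat n n"
    using W H(2) by (intro mult_carrier_mat[of _ n n] mat_adjoint_carrier)
  moreover have "mat_adjoint (W * H * mat_adjoint W) = W * H * mat_adjoint W"
    unfolding mat_adjoint_conj[OF W H(2)] H(3) ..
  moreover have "square_mat (W * H * mat_adjoint W)" using carrier_matD[OF c] by simp
  ultimately show ?thesis using H(1) unfolding hamiltonian_on_def hermitian_def by blast
qed

lemma hamiltonian_on_kron_sum: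
  "hamiltonian_on n H \<Longrightarrow> hamiltonian_on m K \<Longrightarrow> hamiltonian_on (n * m) (kron_sum H K)"
  unfolding hamiltonian_on_def by (auto intro: kron_sum_carrier hermitian_kron_sum)

lemma hamiltonian_on_iff: "hamiltonian_on n H \<longleftrightarrow> hamiltonian H \<and> dim_row H = n"
  unfolding hamiltonian_def by (auto simp: hamiltonian_on_def)

section \<open>Free states\<close>

abbreviation levels :: "nat \<Rightarrow> (nat \<Rightarrow> real) \<Rightarrow> complex mat" where
  "levels n d \<equiv> mat_diag n (\<lambda>i. complex_of_real (d i))"

lemma hamiltonian_on_levels: "0 < n \<Longrightarrow> hamiltonian_on n (levels n d)"
  unfolding hamiltonian_on_def hermitian_def
  by (auto intro!: eq_matI simp: mat_diag_def)

locale helmholtz_theory =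
  fixes F :: "state set"
  assumes unique: "unique_free_states F" and nontrivial: "nontrivial_theory F"
begin

abbreviation g :: "complex mat \<Rightarrow> complex mat" where "g \<equiv> free_density F"

section \<open>Covariance and multiplicativity of the free state\<close>

lemma free_density_mem:
  assumes "hamiltonian H"
  shows "(g H, H) \<in> F"
proof -
  have "\<exists>!\<rho>. (\<rho>, H) \<in> F" using unique assms unfolding unique_free_states_def by simp
  from theI'[OF this] show ?thesis unfolding free_density_def .
qed

lemma free_density_eqI:
  assumes "(\<rho>, H) \<in> F"
  shows "g H = \<rho>"
proof -
  have "hamiltonian H" using assms unique unfolding unique_free_states_def is_state_def by auto
  then have "\<exists>!\<rho>. (\<rho>, H) \<in> F" using unique unfolding unique_free_states_def by simp
  from the1_equality[OF this assms] show ?thesis unfolding free_density_def .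
qed

lemma free_density_density:
  assumes "hamiltonian_on n H"
  shows "g H \<in> carrier_mat n n" "hermitian (g H)" "mat_trace (g H) = 1"
  using free_density_mem[of H] assms unique
  unfolding unique_free_states_def is_state_def density_on_def hamiltonian_on_iff by auto

text \<open>A single equilibrating operation on the free state of \<open>H\<close> reaches the state
  on the right: add the free state of \<open>K\<close> and discard a trivial factor along the
  identification \<open>W\<close>. By nontriviality the result is free, and by uniqueness it is the
  value of \<open>g\<close>.\<close>

lemma free_density_conj_compose:
  assumes H: "hamiltonian_on n H" and K: "hamiltonian_on m K" and W: "unitary_on (n * m) W"
  shows "g (W * kron_sum H K * mat_adjoint W) = W * kron (g H) (g K) * mat_adjoint W"
proof -
  define HK where "HK = kron_sum H K"
  define r where "r = kron (g H) (g K)"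
  note Wd = unitary_onD[OF W]
  have hHK: "hamiltonian_on (n * m) HK" unfolding HK_def using hamiltonian_on_kron_sum[OF H K] .
  then have cHK: "HK \<in> carrier_mat (n * m) (n * m)" unfolding hamiltonian_on_def by simp
  have cr: "r \<in> carrier_mat (n * m) (n * m)"
    unfolding r_def using free_density_density[OF H] free_density_density[OF K] by (intro kron_carrier)
  have comp: "compose (g H, H) (g K, K) = (r, HK)" unfolding compose_def HK_def r_def by simp
  \<comment> \<open>The evolution is the identity; all the freedom comes from \<open>W\<close>,
    which is an arbitrary unitary.\<close>
  have "energy_preserving_evolution (r, HK) (r, HK)"
    unfolding energy_preserving_evolution_def
    using cHK cr by (intro exI[of _ "1\<^sub>m (n * m)"]) auto
  moreover have "discards_subsystem (r, HK) (W * r * mat_adjoint W, W * HK * mat_adjoint W)"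
    unfolding discards_subsystem_def
  proof (intro exI conjI)
    show "dim_row (snd (r, HK)) = 1 * (n * m)" using cHK by simp
    show "unitary_on (1 * (n * m)) W" using W by simp
    show "hamiltonian_on 1 (0\<^sub>m 1 1)" by (rule hamiltonian_on_zero)
    show hW: "hamiltonian_on (n * m) (W * HK * mat_adjoint W)" by (rule hamiltonian_on_conj[OF hHK W])
    then show "W * snd (r, HK) * mat_adjoint W = kron_sum (0\<^sub>m 1 1) (W * HK * mat_adjoint W)"
      by (simp add: hamiltonian_on_def kron_sum_zero_left[of _ "n * m"] del: One_nat_def)
    have "W * r * mat_adjoint W \<in> carrier_mat (n * m) (n * m)"
      using Wd(1) cr by (intro mult_carrier_mat[of _ "n * m" "n * m"] mat_adjoint_carrier)
    from partial_trace_fst_one[OF this]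
    show "(W * r * mat_adjoint W, W * HK * mat_adjoint W) =
      (partial_trace_fst 1 (n * m) (W * fst (r, HK) * mat_adjoint W), W * HK * mat_adjoint W)" by simp
  qed
  ultimately have "equilibrating_operation F (g H, H) (W * r * mat_adjoint W, W * HK * mat_adjoint W)"
    unfolding equilibrating_operation_def comp[symmetric]
    using free_density_mem[of K] K unfolding hamiltonian_on_iff by blast
  then have "(W * r * mat_adjoint W, W * HK * mat_adjoint W) \<in> F"
    using nontrivial free_density_mem[of H] H unfolding nontrivial_theory_def
    by (auto simp: hamiltonian_on_iff)
  then show ?thesis using free_density_eqI unfolding r_def HK_def by blast
qed

lemma free_density_compose:
  assumes H: "hamiltonian_on n H" and K: "hamiltonian_on m K"
  shows "g (kron_sum H K) = kron (g H) (g K)"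
proof -
  have "kron_sum H K \<in> carrier_mat (n * m) (n * m)"
    using hamiltonian_on_kron_sum[OF H K] unfolding hamiltonian_on_def by simp
  moreover have "kron (g H) (g K) \<in> carrier_mat (n * m) (n * m)"
    using free_density_density[OF H] free_density_density[OF K] by (intro kron_carrier)
  ultimately show ?thesis
    using free_density_conj_compose[OF H K unitary_on_one]
    by (metis mat_adjoint_one left_mult_one_mat right_mult_one_mat)
qed

lemma free_density_conj:
  assumes H: "hamiltonian_on n H" and W: "unitary_on n W"
  shows "g (W * H * mat_adjoint W) = W * g H * mat_adjoint W"
proof -
  note Z = free_density_density[OF hamiltonian_on_zero]
  \<comment> \<open>Trace one leaves only one density operator in dimension one.\<close>
  have "g (0\<^sub>m 1 1) = 1\<^sub>m 1"
    using Z(1,3) by (intro eq_matI) (auto simp: mat_trace_def)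
  then show ?thesis
    using free_density_conj_compose[OF H hamiltonian_on_zero, of W] W H free_density_density(1)[OF H]
    by (simp add: hamiltonian_on_def kron_one_right kron_sum_zero_right[of H n] del: One_nat_def)
qed

text \<open>Such a \<open>W\<close> fixes \<open>H\<close> under conjugation, so by covariance it
  fixes \<open>g H\<close>: every unitary symmetry of the Hamiltonian is one of its free
  state.\<close>

lemma free_density_commute:
  assumes H: "hamiltonian_on n H" and W: "unitary_on n W" and comm: "W * H = H * W"
  shows "W * g H = g H * W"
proof -
  note Wd = unitary_onD[OF W]
  have cH: "H \<in> carrier_mat n n" using H unfolding hamiltonian_on_def by simp
  note cg = free_density_density(1)[OF H]
  have "W * H * mat_adjoint W = H"
    unfolding comm using Wd cH by (simp add: assoc_mult_mat[of _ n n _ n _ n])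
  then have "g H * W = W * g H * mat_adjoint W * W" using free_density_conj[OF H W] by simp
  also have "\<dots> = W * g H * (mat_adjoint W * W)"
    using Wd(1) cg by (intro assoc_mult_mat[of _ n n _ n _ n]) auto
  also have "\<dots> = W * g H" using Wd cg by simp
  finally show ?thesis by simp
qed

section \<open>Populations of diagonal Hamiltonians\<close>

definition population :: "nat \<Rightarrow> (nat \<Rightarrow> real) \<Rightarrow> nat \<Rightarrow> real" where
  "population n d i = Re (g (levels n d) $$ (i, i))"

text \<open>Diagonality comes from phase symmetries of the Hamiltonian, which also rule out
  coherences inside a degenerate level; commuting with the Hamiltonian alone would allow
  those.\<close>

lemma free_density_levels:
  assumes n: "0 < n"
  shows "g (levels n d) = levels n (population n d)"
proof (intro eq_matI)
  note H = hamiltonian_on_levels[OF n, of d]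
  note gd = free_density_density[OF H]
  fix i j assume "i < dim_row (levels n (population n d))" "j < dim_col (levels n (population n d))"
  then have ij: "i < n" "j < n" by (auto simp: mat_diag_def)
  show "g (levels n d) $$ (i, j) = levels n (population n d) $$ (i, j)"
  proof (cases "i = j")
    case True
    \<comment> \<open>Hermiticity makes the diagonal entries real, so taking \<open>Re\<close> in
      \<open>population\<close> loses nothing.\<close>
    have "cnj (g (levels n d) $$ (i, i)) = g (levels n d) $$ (i, i)"
      using hermitian_index[OF gd(2), of i i] gd(1) ij by simp
    then show ?thesis using True ij
      by (simp add: population_def mat_diag_def complex_eq_iff)
  next
    case False
    \<comment> \<open>Flipping the phase of level \<open>i\<close> commutes with the Hamiltonian, and negates this entry.\<close>
    define W :: "complex mat" where "W = mat_diag n (\<lambda>k. if k = i then - 1 else 1)"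
    have cW: "W \<in> carrier_mat n n" unfolding W_def by simp
    have "mat_adjoint W = W" unfolding W_def by (intro eq_matI) (auto simp: mat_diag_def)
    moreover have "W * W = 1\<^sub>m n" unfolding W_def mat_diag_diag mat_diag_one[symmetric]
      by (intro arg_cong[of _ _ "mat_diag n"]) auto
    ultimately have uW: "unitary_on n W" using unitary_onI[OF cW] by simp
    have "W * levels n d = levels n d * W" unfolding W_def mat_diag_diag by (simp add: mult.commute)
    from free_density_commute[OF H uW this]
    have "(W * g (levels n d)) $$ (i, j) = (g (levels n d) * W) $$ (i, j)" by simp
    then have "- (g (levels n d) $$ (i, j)) = g (levels n d) $$ (i, j)"
      unfolding W_def mat_diag_mult_left[OF gd(1)] mat_diag_mult_right[OF gd(1)] using ij False by simp
    then show ?thesis using ij False by (simp add: mat_diag_def)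
  qed
qed (use carrier_matD[OF free_density_density(1)[OF hamiltonian_on_levels[OF n, of d]]] in \<open>auto simp: mat_diag_def\<close>)

lemma sum_population:
  assumes "0 < n"
  shows "(\<Sum>i<n. population n d i) = 1"
proof -
  have "mat_trace (levels n (population n d)) = 1"
    using free_density_density(3)[OF hamiltonian_on_levels[OF assms, of d]]
    unfolding free_density_levels[OF assms] .
  then have "complex_of_real (\<Sum>i<n. population n d i) = 1"
    unfolding mat_trace_def by (simp add: mat_diag_def)
  then show ?thesis by (metis of_real_eq_1_iff)
qed

text \<open>The permutation matrix \<open>W\<close> exchanging two levels of equal energy is a
  symmetry of the Hamiltonian, hence of its free state.\<close>

lemma population_degenerate:
  assumes ij: "i < n" "j < n" and d: "d i = d j"
  shows "population n d i = population n d j"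
proof -
  have n: "0 < n" using ij by simp
  define \<tau> where "\<tau> k = (if k = i then j else if k = j then i else k)" for k
  have \<tau>: "\<tau> k < n" if "k < n" for k using that ij unfolding \<tau>_def by auto
  have \<tau>_inj: "\<tau> k = \<tau> l \<longleftrightarrow> k = l" for k l unfolding \<tau>_def by auto
  have \<tau>d: "d (\<tau> k) = d k" for k using d unfolding \<tau>_def by auto
  define W :: "complex mat" where "W = mat n n (\<lambda>(k, l). if k = \<tau> l then 1 else 0)"
  have cW: "W \<in> carrier_mat n n" unfolding W_def by simp
  have "mat_adjoint W * W = 1\<^sub>m n"
  proof (intro eq_matI)
    fix a b assume "a < dim_row (1\<^sub>m n :: complex mat)" "b < dim_col (1\<^sub>m n :: complex mat)"
    then have ab: "a < n" "b < n" by auto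
    have "(mat_adjoint W * W) $$ (a, b) = (\<Sum>k<n. cnj (W $$ (k, a)) * W $$ (k, b))"
      using ab cW by (simp add: scalar_prod_def atLeast0LessThan)
    also have "\<dots> = (\<Sum>k<n. (if k = \<tau> a then if k = \<tau> b then 1 else 0 else 0))"
      using ab by (intro sum.cong) (auto simp: W_def)
    also have "\<dots> = 1\<^sub>m n $$ (a, b)" using ab \<tau>[OF ab(1)] by (simp add: \<tau>_inj)
    finally show "(mat_adjoint W * W) $$ (a, b) = 1\<^sub>m n $$ (a, b)" .
  qed (use cW in auto)
  then have uW: "unitary_on n W" using unitary_onI[OF cW] by blast
  have "W * levels n d = levels n d * W"
    unfolding mat_diag_mult_left[OF cW] mat_diag_mult_right[OF cW]
    by (intro eq_matI) (auto simp: W_def \<tau>d)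
  from free_density_commute[OF hamiltonian_on_levels[OF n] uW this]
  \<comment> \<open>Since \<open>W\<close> has entry 1 at \<open>(i, j)\<close>, the left side is
    the population of \<open>j\<close> and the right side that of \<open>i\<close>.\<close>
  have "(W * levels n (population n d)) $$ (i, j) = (levels n (population n d) * W) $$ (i, j)"
    unfolding free_density_levels[OF n] by simp
  then show ?thesis
    unfolding mat_diag_mult_left[OF cW] mat_diag_mult_right[OF cW] using ij
    by (simp add: W_def \<tau>_def split: if_splits)
qed

lemma population_compose:
  assumes "i < n" "k < m"
  shows "population (n * m) (\<lambda>l. d (l div m) + e (l mod m)) (i * m + k)
    = population n d i * population m e k"
proof -
  have nm: "0 < n" "0 < m" using assms by auto
  have idx: "i * m + k < n * m" using assms by (rule pair_index_less)
  have "levels (n * m) (\<lambda>l. d (l div m) + e (l mod m)) = kron_sum (levels n d) (levels m e)"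
    unfolding kron_sum_mat_diag by simp
  then have "g (levels (n * m) (\<lambda>l. d (l div m) + e (l mod m)))
      = kron (levels n (population n d)) (levels m (population m e))"
    using free_density_compose[OF hamiltonian_on_levels[OF nm(1)] hamiltonian_on_levels[OF nm(2)]]
    by (simp add: free_density_levels nm)
  then show ?thesis
    unfolding population_def[of "n * m"] kron_mat_diag using idx assms by (simp add: mat_diag_def)
qed

text \<open>The product levels \<open>(i, k)\<close> and \<open>(j, l)\<close> of the composite are
  degenerate, so their populations, which are products, agree.\<close>

lemma population_exchange:
  assumes "i < n" "j < n" "k < m" "l < m" "d i + e k = d j + e l"
  shows "population n d i * population m e k = population n d j * population m e l"
proof -
  have "i * m + k < n * m" "j * m + l < n * m"
    using assms by (auto intro: pair_index_less)
  from population_degenerate[OF this, of "\<lambda>l. d (l div m) + e (l mod m)"] assms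
  show ?thesis by (simp add: population_compose)
qed

section \<open>Two-level systems and the Boltzmann factor\<close>

abbreviation gap :: "real \<Rightarrow> nat \<Rightarrow> real" where
  "gap x i \<equiv> if i = 1 then x else 0"

lemma qubit_hamiltonian_levels: "qubit_hamiltonian x = levels 2 (gap x)"
  unfolding qubit_hamiltonian_def by (intro eq_matI) (auto simp: mat_diag_def)

lemma population_gap_upper: "population 2 (gap x) 1 = 1 - population 2 (gap x) 0"
  using sum_population[of 2 "gap x"] by (simp add: numeral_2_eq_2)

lemma population_gap_functional_equation:
  fixes x y :: real
  defines "p \<equiv> \<lambda>x. population 2 (gap x) 0"
  shows "p x * p y * (1 - p (x + y)) = (1 - p x) * (1 - p y) * p (x + y)"
proof -
  let ?d = "\<lambda>l. gap x (l div 2) + gap y (l mod 2)"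
  \<comment> \<open>In the pair of qubits, index 0 is \<open>(0, 0)\<close> with energy 0 and index
    3 is \<open>(1, 1)\<close> with energy \<open>x + y\<close>. The third qubit, excited in the
    first case only, supplies the difference.\<close>
  have "population (2 * 2) ?d 0 * population 2 (gap (x + y)) 1
      = population (2 * 2) ?d 3 * population 2 (gap (x + y)) 0"
    by (intro population_exchange) auto
  moreover have "population (2 * 2) ?d 0 = p x * p y"
    using population_compose[of 0 2 0 2 "gap x" "gap y"] unfolding p_def by simp
  moreover have "population (2 * 2) ?d 3 = (1 - p x) * (1 - p y)"
    using population_compose[of 1 2 1 2 "gap x" "gap y"] population_gap_upper unfolding p_def by simp
  ultimately show ?thesis using population_gap_upper unfolding p_def by simp
qed

lemma population_Boltzmann:
  assumes \<beta>: "\<And>x. population 2 (gap x) 0 \<noteq> 0 \<and>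
      1 - population 2 (gap x) 0 = population 2 (gap x) 0 * exp (- \<beta> * x)"
    and i: "i < n"
  shows "population n d i = exp (- \<beta> * d i) / (\<Sum>l<n. exp (- \<beta> * d l))"
proof -
  have ratio: "population n d k = population n d i * exp (- \<beta> * (d k - d i))" if "k < n" for k
  proof -
    let ?x = "d k - d i"
    \<comment> \<open>The gap may be negative: index 0 of the qubit has energy 0 but need not be its
      ground level.\<close>
    have "population n d k * population 2 (gap ?x) 0 = population n d i * population 2 (gap ?x) 1"
      using that i by (intro population_exchange) auto
    then have "population n d k * population 2 (gap ?x) 0
        = population n d i * exp (- \<beta> * ?x) * population 2 (gap ?x) 0"
      unfolding population_gap_upper using \<beta>[of ?x] by simp
    then show ?thesis using \<beta>[of ?x] by simp
  qed
  \<comment> \<open>Normalisation turns the ratios to level \<open>i\<close> into the absolute value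
    of its population.\<close>
  have "1 = (\<Sum>k<n. population n d k)" using sum_population[of n d] i by simp
  also have "\<dots> = (\<Sum>k<n. population n d i * exp (- \<beta> * (d k - d i)))"
    by (intro sum.cong ratio) auto
  also have "\<dots> = (\<Sum>k<n. population n d i * (exp (- \<beta> * d k) / exp (- \<beta> * d i)))"
    by (intro sum.cong) (simp_all add: exp_diff[symmetric] algebra_simps)
  also have "\<dots> = population n d i * (\<Sum>k<n. exp (- \<beta> * d k)) / exp (- \<beta> * d i)"
    by (simp add: sum_distrib_left sum_divide_distrib)
  finally have "exp (- \<beta> * d i) = population n d i * (\<Sum>k<n. exp (- \<beta> * d k))"
    by (simp add: field_simps)
  moreover from this have "(\<Sum>k<n. exp (- \<beta> * d k)) \<noteq> 0" by (metis exp_not_eq_zero mult_zero_right)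
  ultimately show ?thesis by (simp only: nonzero_mult_div_cancel_right not_False_eq_True)
qed

end

theorem mainTheorem7:
  fixes F :: "state set"
  assumes "unique_free_states F"
    and "nontrivial_theory F"
    and "regular_at_degeneracy F"
  shows "\<exists>\<beta>::real. \<forall>H. hamiltonian H \<longrightarrow> free_density F H = canonical_density \<beta> H"
proof -
  interpret helmholtz_theory F using assms(1,2) by unfold_locales
  let ?p = "\<lambda>x. population 2 (gap x) 0"
  \<comment> \<open>At gap zero the two levels are degenerate and share the total population
    1.\<close>
  have "?p 0 = 1 / 2"
    using population_gap_upper[of 0] population_degenerate[of 0 2 1 "gap 0"] by simp
  moreover have "isCont ?p 0"
    using assms(3) unfolding regular_at_degeneracy_def qubit_hamiltonian_levels population_def
    by (rule isCont_Re)
  ultimately obtain \<beta> where \<beta>: "\<And>x. ?p x \<noteq> 0 \<and> 1 - ?p x = ?p x * exp (- \<beta> * x)"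
    using two_level_functional_equation[of ?p] population_gap_functional_equation by blast
  \<comment> \<open>The constant \<beta> is fixed before \<open>H\<close> is chosen. Covariance
    reduces each \<open>H\<close> to its diagonal form in an eigenbasis.\<close>
  have "g H = canonical_density \<beta> H" if "hamiltonian H" for H
  proof -
    define n where "n = dim_row H"
    have H: "hamiltonian_on n H" using that unfolding n_def hamiltonian_def .
    then have n: "0 < n" unfolding hamiltonian_on_def by simp
    from H obtain V d where V: "unitary_on n V" and eq: "H = V * levels n d * mat_adjoint V"
      using hermitian_unitarily_diagonalizable unfolding hamiltonian_on_def by blast
    have "g H = V * levels n (population n d) * mat_adjoint V"
      unfolding eq free_density_conj[OF hamiltonian_on_levels[OF n] V] free_density_levels[OF n] ..
    also have "levels n (population n d) = levels n (\<lambda>i. exp (- \<beta> * d i) / (\<Sum>l<n. exp (- \<beta> * d l)))"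
      using population_Boltzmann[OF \<beta>] by (intro eq_matI) (auto simp: mat_diag_def)
    finally show ?thesis unfolding eq canonical_density_conj_mat_diag[OF V] .
  qed
  then show ?thesis by blast
qed

end
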